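(* The Prime $k$-tuples Conjecture implies that there are infinitely many Lucas-Carmichael integers of degree $4$ with exactly seven prime factors.
   Context: A Lucas-Carmichael integer is a square-free positive composite integer $n$ such that $p+1 \mid n+1$ for every prime $p$ dividing $n$. For an integer $b\ge 2$ and a positive integer $N$, $S_b(N)$ denotes the sum of the base-$b$ digits of $N$. The degree of a Lucas-Carmichael integer $n$ is the integer $\alpha = \max_{p\mid n} \frac{S_{p+2}(n+2)-1}{p+1}$, the maximum being over the prime divisors $p$ of $n$. Prime $k$-tuples Conjecture: Let $a_1,\ldots,a_k$ be positive integers, and let $b_1,\ldots,b_k$ be nonzero integers. For $m\ge 1$, define $f(m)=\prod_{i=1}^k (a_i m+b_i)$. Let $P(x)$ denote the number of positive integers $m\le x$ for which $a_i m+b_i$ is prime for each $i=1,\ldots,k$. The conjecture states that if no prime divides $f(m)$ for every $m$, then there exists $c>0$ such that $P(x)\sim \frac{cx}{\log^k x}$ as $x\to\infty$. *)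

theory Defs
  imports
    Complex_Main
    "HOL-Computational_Algebra.Computational_Algebra"
    "HOL-Library.Landau_Symbols"
begin

text \<open>The test \<open>b < 2\<close> only ensures termination; the intended domain is \<open>b \<ge> 2\<close>.\<close>

fun digit_sum :: "nat \<Rightarrow> nat \<Rightarrow> nat" where
  "digit_sum b N = (if N = 0 \<or> b < 2 then 0 else N mod b + digit_sum b (N div b))"

declare digit_sum.simps [simp del]

definition lucas_carmichael :: "nat \<Rightarrow> bool" where
  "lucas_carmichael n \<longleftrightarrow>
     n > 1 \<and> \<not> prime n \<and> squarefree n \<and> (\<forall>p. prime p \<and> p dvd n \<longrightarrow> p + 1 dvd n + 1)"

text \<open>
  The quotients are taken in the rationals, so nothing is rounded. For a Lucas-Carmichael
  integer \<open>n\<close> they are integers, because \<open>digit_sum (p + 2) (n + 2)\<close> is congruent to \<open>n + 2\<close>,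
  hence to 1, modulo \<open>p + 1\<close>.
\<close>

definition lc_degree :: "nat \<Rightarrow> rat" where
  "lc_degree n =
     Max ((\<lambda>p. (of_nat (digit_sum (p + 2) (n + 2)) - 1) / of_nat (p + 1)) ` prime_factors n)"

definition prime_tuple_count :: "nat \<Rightarrow> (nat \<Rightarrow> int) \<Rightarrow> (nat \<Rightarrow> int) \<Rightarrow> real \<Rightarrow> nat" where
  "prime_tuple_count k a b x =
     card {m::nat. m \<ge> 1 \<and> real m \<le> x \<and> (\<forall>i\<in>{1..k}. prime (a i * int m + b i))}"

text \<open>
  The linear forms are required to be pairwise distinct. This is implicit in the usual
  formulation of the conjecture and cannot be dropped: repeating a form changes \<open>k\<close> but not the
  count, so the asymptotics for \<open>m + 1\<close> and for the pair \<open>m + 1, m + 1\<close> contradict each other.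
\<close>

definition prime_k_tuples_conjecture :: bool where
  "prime_k_tuples_conjecture \<longleftrightarrow>
     (\<forall>(k::nat) (a::nat \<Rightarrow> int) (b::nat \<Rightarrow> int).
        k \<ge> 1 \<longrightarrow>
        (\<forall>i\<in>{1..k}. a i > 0 \<and> b i \<noteq> 0) \<longrightarrow>
        inj_on (\<lambda>i. (a i, b i)) {1..k} \<longrightarrow>
        \<not> (\<exists>p::int. prime p \<and> (\<forall>m::nat. m \<ge> 1 \<longrightarrow> p dvd (\<Prod>i=1..k. a i * int m + b i))) \<longrightarrow>
        (\<exists>c::real. c > 0 \<and>
           (\<lambda>x::real. real (prime_tuple_count k a b x)) \<sim>[at_top] (\<lambda>x. c * x / ln x ^ k)))"

end

theory Submission
  imports Defs "HOL-Real_Asymp.Real_Asymp"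
begin

text \<open>
  If \<open>c\<close> runs over the coefficients \<open>1, 2, 3, 4, 6, 8, 24\<close>, each of which divides their sum 48,
  then the forms \<open>c M - 1\<close> have a product \<open>n\<close> that satisfies \<open>c M dvd n + 1\<close> as soon as \<open>M\<close> is divisible
  by 24. In the base \<open>b = c M + 1\<close> attached to the factor \<open>c M - 1\<close> we have \<open>M = (b - 1) / c\<close>, so
  \<open>n + 2\<close> is a polynomial in \<open>b\<close> with constant rational coefficients. When \<open>M\<close> is a multiple of a
  sufficiently high power of 24, here \<open>M = 24 ^ 3 t\<close>, its base-\<open>b\<close> digits are linear functions of
  \<open>t\<close> for all large \<open>t\<close>, and their sum is \<open>1 + \<alpha> c M\<close> with \<open>\<alpha> = 3\<close> for \<open>c = 4, 8\<close> and
  \<open>\<alpha> = 4\<close> for the other coefficients. Since no prime \<open>p\<close> divides any of the forms at \<open>t = p\<close>, the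
  Prime \<open>k\<close>-tuples Conjecture makes all seven forms prime infinitely often.
\<close>

section \<open>Digit sums certified by digit lists\<close>

text \<open>Base-\<open>b\<close> digits are unique, so any list of entries in range, lowest first,
  certifies a digit sum by bounds and one identity. Integer entries avoid truncated subtraction in
  digits such as \<open>1024 * x - 6916\<close>.\<close>

lemma digit_sum_horner_sum:
  fixes ds :: "int list"
  assumes "b \<ge> 2" "\<And>d. d \<in> set ds \<Longrightarrow> 0 \<le> d \<and> d < int b"
    and "int N = horner_sum (\<lambda>d. d) (int b) ds"
  shows "int (digit_sum b N) = sum_list ds"
  using assms(2,3)
proof (induction ds arbitrary: N)
  case Nil
  then show ?case by (simp add: digit_sum.simps)
next
  case (Cons d ds)
  let ?N' = "N div b"
  have d: "0 \<le> d" "d < int b" using Cons.prems(1) by auto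
  have N: "int N = d + int b * horner_sum (\<lambda>d. d) (int b) ds" using Cons.prems(2) by simp
  have m: "int (N mod b) = d" using d N by (simp add: zmod_int)
  have "int ?N' = horner_sum (\<lambda>d. d) (int b) ds"
    using d N assms(1) by (simp add: zdiv_int)
  then have "int (digit_sum b ?N') = sum_list ds"
    using Cons.prems(1) by (intro Cons.IH) auto
  \<comment> \<open>For \<open>N = 0\<close> both sides vanish, so leading zeros in the list do no
    harm.\<close>
  moreover have "digit_sum b N = N mod b + digit_sum b ?N'"
    using assms(1) by (subst digit_sum.simps) (auto simp: digit_sum.simps)
  ultimately show ?case using m by simp
qed

section \<open>Simultaneous primes from the conjecture\<close>

text \<open>The predicted count \<open>c * x / ln x ^ k\<close> tends to infinity, so it would
  outgrow the cardinality of a finite solution set. Taking the coefficients from a set makes the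
  forms pairwise distinct.\<close>

lemma infinite_prime_tuples:
  fixes A :: "nat set"
  assumes conj: prime_k_tuples_conjecture
    and A: "finite A" "A \<noteq> {}" "0 \<notin> A"
  shows "infinite {m::nat. m \<ge> 1 \<and> (\<forall>c\<in>A. prime (int c * int m - 1))}"
    (is "infinite ?S")
proof
  assume fin: "finite ?S"
  define k where "k = card A"
  obtain h where h: "bij_betw h {1..k} A"
    using ex_bij_betw_nat_finite_1[OF A(1)] unfolding k_def by blast
  have hA: "h i \<in> A" if "i \<in> {1..k}" for i using h that by (auto simp: bij_betw_def)
  define a where "a = (\<lambda>i. int (h i))"
  have "k \<ge> 1" using A by (simp add: k_def Suc_leI card_gt_0_iff)
  moreover have "\<forall>i\<in>{1..k}. a i > 0 \<and> (-1::int) \<noteq> 0"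
  proof
    fix i assume "i \<in> {1..k}"
    then have "h i \<noteq> 0" using hA[of i] A(3) by (metis (full_types))
    then show "a i > 0 \<and> (-1::int) \<noteq> 0" by (simp add: a_def)
  qed
  moreover have "inj_on (\<lambda>i. (a i, -1::int)) {1..k}"
    using bij_betw_imp_inj_on[OF h] by (intro inj_onI) (metis Pair_inject a_def inj_onD of_nat_eq_iff)
  moreover have "\<not> (\<exists>p::int. prime p \<and> (\<forall>m::nat. m \<ge> 1 \<longrightarrow> p dvd (\<Prod>i=1..k. a i * int m + -1)))"
  proof
    assume "\<exists>p::int. prime p \<and> (\<forall>m::nat. m \<ge> 1 \<longrightarrow> p dvd (\<Prod>i=1..k. a i * int m + -1))"
    then obtain p :: int where p: "prime p"
      and "\<And>m::nat. m \<ge> 1 \<Longrightarrow> p dvd (\<Prod>i=1..k. a i * int m + -1)" by blast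
    from this(2)[of "nat p"] have "p dvd (\<Prod>i=1..k. a i * p + -1)"
      using prime_gt_1_int[OF p] by simp
    then obtain i where "p dvd a i * p + -1"
      using p by (auto simp: prime_dvd_prod_iff)
    then have "p dvd 1" by (metis dvd_add_right_iff dvd_minus_iff dvd_triv_right)
    then show False using p by (simp add: not_prime_unit)
  qed
  ultimately obtain c :: real where c: "c > 0"
    and eq: "(\<lambda>x. real (prime_tuple_count k a (\<lambda>_. -1) x)) \<sim>[at_top] (\<lambda>x. c * x / ln x ^ k)"
    using conj[unfolded prime_k_tuples_conjecture_def, rule_format, of k a "\<lambda>_. -1"] by blast
  have "filterlim (\<lambda>x. c * x / ln x ^ k) at_top at_top"
    using c by real_asymp
  then have "filterlim (\<lambda>x. real (prime_tuple_count k a (\<lambda>_. -1) x)) at_top at_top"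
    using asymp_equiv_at_top_transfer[OF asymp_equiv_symI[OF eq]] by blast
  then have "\<forall>\<^sub>F x in at_top. real (prime_tuple_count k a (\<lambda>_. -1) x) > real (card ?S)"
    unfolding filterlim_at_top_dense by blast
  then obtain x where x: "card ?S < prime_tuple_count k a (\<lambda>_. -1) x"
    by (auto simp: eventually_at_top_linorder)
  have "A = h ` {1..k}" using h by (simp add: bij_betw_def)
  then have "prime_tuple_count k a (\<lambda>_. -1) x \<le> card ?S"
    unfolding prime_tuple_count_def using fin
    by (intro card_mono) (auto simp: a_def)
  then show False using x by simp
qed

section \<open>The seven factors and the digits of their product\<close>

definition lc_multipliers :: "nat set" where
  "lc_multipliers = {1, 2, 3, 4, 6, 8, 24}"

text \<open>The constant is \<open>24 ^ 3\<close>. The subtraction truncates only if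
  \<open>c * t = 0\<close>.\<close>

definition lc_factor :: "nat \<Rightarrow> nat \<Rightarrow> nat" where
  "lc_factor t c = 13824 * c * t - 1"

definition lc_product :: "nat \<Rightarrow> nat" where
  "lc_product t = (\<Prod>c\<in>lc_multipliers. lc_factor t c)"

lemma multipliers_pos: "c \<in> lc_multipliers \<Longrightarrow> c > 0"
  by (auto simp: lc_multipliers_def)

lemma int_lc_factor:
  assumes "t \<ge> 1" "c \<ge> 1"
  shows "int (lc_factor t c) = 13824 * int c * int t - 1"
  using assms by (simp add: lc_factor_def of_nat_diff)

lemma int_lc_product:
  assumes "t \<ge> 1"
  shows "int (lc_product t) =
    (13824 * int t - 1) * ((27648 * int t - 1) * ((41472 * int t - 1) * ((55296 * int t - 1) *
    ((82944 * int t - 1) * ((110592 * int t - 1) * (331776 * int t - 1))))))"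
  using assms by (simp add: lc_product_def lc_multipliers_def int_lc_factor)

lemma digit_sum_lc_product:
  assumes t: "t \<ge> 1000" and c: "c \<in> lc_multipliers"
  shows "digit_sum (lc_factor t c + 2) (lc_product t + 2) =
    1 + (if c \<in> {4, 8} then 3 else 4) * (lc_factor t c + 1)"
proof -
  define x where "x = int t"
  have x: "x \<ge> 1000" using t by (simp add: x_def)
  define b where "b = lc_factor t c + 2"
  have b: "int b = 13824 * int c * x + 1"
    using t multipliers_pos[OF c] by (simp add: b_def x_def int_lc_factor)
  have n: "int (lc_product t + 2) =
    (13824 * x - 1) * ((27648 * x - 1) * ((41472 * x - 1) * ((55296 * x - 1) *
    ((82944 * x - 1) * ((110592 * x - 1) * (331776 * x - 1)))))) + 2"
    using t by (simp add: int_lc_product x_def)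
  have digits: ?thesis
    if "\<forall>d\<in>set ds. 0 \<le> d \<and> d < 13824 * int c * x + 1"
      and "sum_list ds = 1 + (if c \<in> {4, 8} then 3 else 4) * (13824 * int c * x)"
      and "(13824 * x - 1) * ((27648 * x - 1) * ((41472 * x - 1) * ((55296 * x - 1) *
        ((82944 * x - 1) * ((110592 * x - 1) * (331776 * x - 1)))))) + 2 =
      horner_sum (\<lambda>d. d) (13824 * int c * x + 1) ds" for ds
  proof -
    have "int (digit_sum b (lc_product t + 2)) = sum_list ds"
    proof (rule digit_sum_horner_sum)
      show "2 \<le> b" by (simp add: b_def)
      show "int (lc_product t + 2) = horner_sum (\<lambda>d. d) (int b) ds"
        unfolding n b by (fact that(3))
    qed (use that(1) b in auto)
    also have "\<dots> = int (1 + (if c \<in> {4, 8} then 3 else 4) * (lc_factor t c + 1))"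
      using that(2) b by (simp add: b_def algebra_simps)
    finally show ?thesis unfolding b_def by linarith
  qed
  \<comment> \<open>The lists come from normalising the coefficients of \<open>n + 2\<close> as a
    polynomial in \<open>b\<close>: a fractional part f moves down one place, since f b = f + f (b -
    1) and f (b - 1) is an integer multiple of \<open>x\<close>; a negative digit borrows
    \<open>b\<close> from the next higher place.\<close>
  from c consider "c = 1" | "c = 2" | "c = 3" | "c = 4" | "c = 6" | "c = 8" | "c = 24"
    by (auto simp: lc_multipliers_def)
  then show ?thesis
  proof cases
    \<comment> \<open>Here the coefficients are integers and only borrowing occurs. This case makes
      the strongest demand on \<open>t\<close>: the digit 3022227 must be less than
      \<open>13824 * x + 1\<close>.\<close>
    case 1
    show ?thesis
      by (rule digits[where ds = "[
          13824 * x - 188997, 1024889, 13824 * x - 2368386,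
          3022227, 13824 * x - 2298963, 1041935,
          13824 * x - 260351, 27647]"])
        (use x 1 in \<open>simp_all add: algebra_simps\<close>)
  next
    case 2
    show ?thesis
      by (rule digits[where ds = "[
          27648 * x - 5847, 13824 * x + 26752, 6912 * x - 51752,
          20736 * x + 54843, 13824 * x - 34343, 12688,
          27648 * x - 2555, 215]"])
        (use x 2 in \<open>simp_all add: algebra_simps\<close>)
  next
    case 3
    show ?thesis
      by (rule digits[where ds = "[
          27648 * x - 1024, 26112 * x + 4111, 1024 * x - 6916,
          39424 * x + 6327, 24576 * x - 3393, 20480 * x + 1064,
          26624 * x - 180, 12]"])
        (use x 3 in \<open>simp_all add: algebra_simps\<close>)
  next
    case 4
    show ?thesis
      by (rule digits[where ds = "[
          29376 * x - 342, 7776 * x + 1235, 7776 * x - 1849,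
          2592 * x + 1495, 49248 * x - 703, 31104 * x + 192,
          38016 * x - 28, 1]"])
        (use x 4 in \<open>simp_all add: algebra_simps\<close>)
  next
    \<comment> \<open>From here on the leading coefficient 27648 / c^7 is below 1, so there are
      seven digits instead of eight.\<close>
    case 5
    show ?thesis
      by (rule digits[where ds = "[
          61440 * x - 88, 60928 * x + 272, 13568 * x - 337,
          72448 * x + 223, 34304 * x - 85, 80896 * x + 19,
          8192 * x - 3]"])
        (use x 5 in \<open>simp_all add: algebra_simps\<close>)
  next
    case 6
    show ?thesis
      by (rule digits[where ds = "[
          66960 * x - 38, 22572 * x + 105, 104814 * x - 111,
          27324 * x + 62, 34992 * x - 20, 73656 * x + 4,
          1458 * x - 1]"])
        (use x 6 in \<open>simp_all add: algebra_simps\<close>)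
  next
    case 7
    show ?thesis
      by (rule digits[where ds = "[
          310896 * x - 2, 137932 * x + 6, 249878 * x - 3,
          293620 * x + 1, 3128 * x - 1, 331648 * x + 1,
          2 * x - 1]"])
        (use x 7 in \<open>simp_all add: algebra_simps\<close>)
  qed
qed


section \<open>The Lucas-Carmichael property and the degree\<close>

text \<open>Casting out \<open>b - 1\<close>: replacing \<open>N\<close> by
  \<open>N div b + N mod b\<close> changes it by \<open>(b - 1) * (N div b)\<close>.\<close>

lemma dvd_diff_digit_sum:
  assumes "b \<ge> 2"
  shows "int b - 1 dvd int N - int (digit_sum b N)"
proof (induction N rule: less_induct)
  case (less N)
  show ?case
  proof (cases "N = 0")
    case True
    then show ?thesis by (simp add: digit_sum.simps)
  next
    case False
    then have "int b - 1 dvd int (N div b) - int (digit_sum b (N div b))"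
      using assms by (intro less.IH) simp
    moreover have "int N = int b * int (N div b) + int (N mod b)"
      by (metis mult_div_mod_eq of_nat_add of_nat_mult)
    moreover have "digit_sum b N = N mod b + digit_sum b (N div b)"
      using False assms by (subst digit_sum.simps) simp
    ultimately have "int N - int (digit_sum b N) =
        (int b - 1) * int (N div b) + (int (N div b) - int (digit_sum b (N div b)))"
      by (simp add: algebra_simps)
    then show ?thesis
      using \<open>int b - 1 dvd int (N div b) - int (digit_sum b (N div b))\<close> by simp
  qed
qed

text \<open>The digit sums already computed give the divisibility, without expanding the product again.\<close>

lemma lc_factor_plus_1_dvd:
  assumes "t \<ge> 1000" "c \<in> lc_multipliers"
  shows "lc_factor t c + 1 dvd lc_product t + 1"
proof -
  let ?p = "lc_factor t c" and ?n = "lc_product t"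
  define k :: int where "k = (if c \<in> {4, 8} then 3 else 4)"
  define k :: int where "k = (if c \<in> {4, 8} then 3 else 4)"
  have "int ?p + 1 dvd int (?n + 2) - int (digit_sum (?p + 2) (?n + 2))"
    using dvd_diff_digit_sum[of "?p + 2" "?n + 2"] by (simp add: algebra_simps)
  \<comment> \<open>The summand 1 of the digit sum turns \<open>?n + 2\<close> into
    \<open>?n + 1\<close>.\<close>
  also have "int (?n + 2) - int (digit_sum (?p + 2) (?n + 2)) =
      int (?n + 1) - k * (int ?p + 1)"
    unfolding digit_sum_lc_product[OF assms] by (simp add: k_def)
  finally have "int ?p + 1 dvd int (?n + 1) - k * (int ?p + 1) + k * (int ?p + 1)"
    by (rule dvd_add) simp
  then have "int (?p + 1) dvd int (?n + 1)" by (simp add: add.commute)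
  then show ?thesis by (simp only: of_nat_dvd_iff)
qed

text \<open>Different multipliers give different primes, so the prime factors correspond to the
  multipliers; compositeness and squarefreeness follow. The bound on \<open>t\<close> serves to make
  these integers unbounded.\<close>

lemma lucas_carmichael_lc_product:
  assumes t: "t \<ge> 1000" and primes: "\<And>c. c \<in> lc_multipliers \<Longrightarrow> prime (lc_factor t c)"
  shows "lucas_carmichael (lc_product t)" "lc_degree (lc_product t) = 4"
    "card (prime_factors (lc_product t)) = 7" "t \<le> lc_product t"
proof -
  let ?n = "lc_product t"
  have inj: "inj_on (lc_factor t) lc_multipliers"
  proof (rule inj_onI)
    fix c d assume cd: "c \<in> lc_multipliers" "d \<in> lc_multipliers" "lc_factor t c = lc_factor t d"
    then have "int (lc_factor t c) = int (lc_factor t d)" by simp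
    then show "c = d"
      using t multipliers_pos[OF cd(1)] multipliers_pos[OF cd(2)] by (simp add: int_lc_factor)
  qed
  have fin: "finite lc_multipliers" by (simp add: lc_multipliers_def)
  have nonzero: "0 \<notin> lc_factor t ` lc_multipliers"
    using primes by (metis imageE not_prime_0)
  have "prime_factors ?n = (\<Union>c\<in>lc_multipliers. prime_factors (lc_factor t c))"
    unfolding lc_product_def using fin nonzero by (subst prime_factors_prod) simp_all
  also have "\<dots> = lc_factor t ` lc_multipliers"
    using primes by (auto simp: prime_factorization_prime)
  finally have pf: "prime_factors ?n = lc_factor t ` lc_multipliers" .
  then show card: "card (prime_factors ?n) = 7"
    using inj by (simp add: card_image lc_multipliers_def)
  \<comment> \<open>The count 7 also excludes the degenerate cases: \<open>prime_factors\<close> is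
    empty at 0 and 1, and a singleton at a prime.\<close>
  have pos: "?n > 0" using card by (intro gr0I) simp
  have "\<not> prime ?n" using card by (auto simp: prime_factorization_prime)
  moreover have "?n \<noteq> 1" using card by auto
  moreover have "squarefree ?n"
    unfolding lc_product_def
  proof (rule squarefree_prod_coprime)
    fix c d assume cd: "c \<in> lc_multipliers" "d \<in> lc_multipliers" "c \<noteq> d"
    then have "lc_factor t c \<noteq> lc_factor t d" using inj by (meson inj_onD)
    then show "coprime (lc_factor t c) (lc_factor t d)"
      using primes cd by (intro primes_coprime)
  qed (use primes squarefree_prime in blast)
  moreover have "p + 1 dvd ?n + 1" if "prime p" "p dvd ?n" for p
  proof -
    have "p \<in> prime_factors ?n" using that pos by (simp add: prime_factors_dvd)
    then show ?thesis using pf lc_factor_plus_1_dvd[OF t] by auto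
  qed
  ultimately show "lucas_carmichael ?n" using pos by (auto simp: lucas_carmichael_def)
  have "(\<lambda>p. (rat_of_nat (digit_sum (p + 2) (?n + 2)) - 1) / rat_of_nat (p + 1)) ` prime_factors ?n =
      (\<lambda>c. if c \<in> {4, 8} then 3 else 4) ` lc_multipliers"
    unfolding pf image_image
  proof (rule image_cong[OF refl])
    fix c assume c: "c \<in> lc_multipliers"
    have "rat_of_nat (digit_sum (lc_factor t c + 2) (?n + 2)) - 1 =
        (if c \<in> {4, 8} then 3 else 4) * rat_of_nat (lc_factor t c + 1)"
      unfolding digit_sum_lc_product[OF t c] by simp
    then show "(rat_of_nat (digit_sum (lc_factor t c + 2) (?n + 2)) - 1) / rat_of_nat (lc_factor t c + 1) =
        (if c \<in> {4, 8} then 3 else 4)"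
      by (simp add: field_simps del: of_nat_add of_nat_Suc)
  qed
  also have "\<dots> = {3, 4}" by (auto simp: lc_multipliers_def)
  finally show "lc_degree ?n = 4" by (simp add: lc_degree_def)
  have "lc_factor t 1 \<in> prime_factors ?n" by (simp add: pf lc_multipliers_def)
  then have "lc_factor t 1 \<le> ?n" using pos by (intro dvd_imp_le) auto
  then show "t \<le> ?n" using t by (simp add: lc_factor_def)
qed

theorem theorem4p5:
  assumes "prime_k_tuples_conjecture"
  shows "infinite {n::nat. lucas_carmichael n \<and> lc_degree n = 4 \<and> card (prime_factors n) = 7}"
  unfolding infinite_nat_iff_unbounded
proof
  fix N :: nat
  \<comment> \<open>The factor 13824 goes into the coefficients, so that the variable of the
    conjecture is \<open>t\<close> itself.\<close>
  let ?A = "(\<lambda>c. 13824 * c) ` lc_multipliers"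
  have "infinite {t::nat. t \<ge> 1 \<and> (\<forall>c\<in>?A. prime (int c * int t - 1))}"
    using assms by (rule infinite_prime_tuples) (auto simp: lc_multipliers_def)
  \<comment> \<open>The offset 1000 makes the digit expansions valid, and \<open>t > N\<close>
    forces the product above \<open>N\<close>.\<close>
  then obtain t where t: "t > N + 1000" "\<forall>c\<in>?A. prime (int c * int t - 1)"
    unfolding infinite_nat_iff_unbounded by blast
  have "prime (lc_factor t c)" if c: "c \<in> lc_multipliers" for c
  proof -
    have "prime (int (lc_factor t c))"
      using t c multipliers_pos[OF c] by (simp add: int_lc_factor)
    then show ?thesis by simp
  qed
  then show "\<exists>n>N. n \<in> {n. lucas_carmichael n \<and> lc_degree n = 4 \<and> card (prime_factors n) = 7}"
    using lucas_carmichael_lc_product[of t] t(1) by (intro exI[of _ "lc_product t"]) auto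
qed

end
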